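(* For every infinite Tychonoff space $X$, $$wd(O(\beta X))\le wd(X),\quad wd(O_\tau(X))\le wd(X),\quad wd(O_R(X))\le wd(X),\quad wd(O_\beta(X))\le wd(X).$$
   Context: For a compact Hausdorff space $K$, $C(K)$ is the space of continuous real-valued functions on $K$ with the pointwise order, and $c_K$ denotes the constant function with value $c\in\mathbb{R}$. $O(K)$ is the set of all functionals $\mu: C(K)\to\mathbb{R}$ (not necessarily linear) that are order-preserving ($\varphi\le\psi$ implies $\mu(\varphi)\le\mu(\psi)$), weakly additive ($\mu(\varphi+c_K)=\mu(\varphi)+c\,\mu(1_K)$ for all $\varphi\in C(K)$, $c\in\mathbb{R}$) and normed ($\mu(1_K)=1$). For a closed subset $A\subset K$, a functional $\mu\in O(K)$ is supported on $A$ if $\mu\in O(A)$, where $O(A)$ is identified with a subset of $O(K)$ via $\nu\mapsto(\varphi\mapsto\nu(\varphi|_A))$; the support $\operatorname{supp}\mu$ is the intersection of all closed $A\subset K$ on which $\mu$ is supported. For a Tychonoff space $X$, $\beta X$ is its Stone-Čech compactification, and: - $O_\tau(X)$ is the set of all $\mu\in O(\beta X)$ that are $\tau$-smooth, i.e. $\mu(\varphi_\alpha)\to 0$ for each net $\{\varphi_\alpha\}\subset C(\beta X)$ that decreases monotonically to zero on $X$ (for every $x\in X$: $\varphi_\alpha(x)\ge\varphi_{\beta}(x)$ whenever $\beta\succ\alpha$, and $\lim_\alpha\varphi_\alpha(x)=0$); - $O_R(X)$ is the set of all $\mu\in O(\beta X)$ that are Radon, i.e. $\mu(\varphi_\alpha)\to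 0$ for each (norm-)bounded net $\{\varphi_\alpha\}\subset C(\beta X)$ which converges to zero uniformly on compact subsets of $X$; - $O_\beta(X)=\{\mu\in O(\beta X): \operatorname{supp}\mu\subset X\}$. All these spaces carry the topology of pointwise convergence on $C(\beta X)$. The weak density $wd(X)$ of a topological space $X$ is the least cardinal number $\tau$ such that $X$ has a $\pi$-base which is the union of $\tau$ centered families of open sets in $X$. (A $\pi$-base is a family of nonempty open sets such that every nonempty open set contains a member of the family; a family is centered if every finite subfamily has nonempty intersection.) *)

theory Defs
  imports "HOL-Analysis.Analysis"
begin

unbundle cardinal_syntax

section \<open>Weak density\<close>

definition pi_base :: "'a topology \<Rightarrow> 'a set set \<Rightarrow> bool" where
  "pi_base X \<B> \<longleftrightarrow>
     (\<forall>B\<in>\<B>. openin X B \<and> B \<noteq> {}) \<and>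
     (\<forall>U. openin X U \<and> U \<noteq> {} \<longrightarrow> (\<exists>B\<in>\<B>. B \<subseteq> U))"

definition centered :: "'a set set \<Rightarrow> bool" where
  "centered \<C> \<longleftrightarrow> (\<forall>\<F>. finite \<F> \<and> \<F> \<subseteq> \<C> \<and> \<F> \<noteq> {} \<longrightarrow> \<Inter>\<F> \<noteq> {})"

definition centered_pi_cover :: "'a topology \<Rightarrow> 'a set set set \<Rightarrow> bool" where
  "centered_pi_cover X \<S> \<longleftrightarrow> (\<forall>\<C>\<in>\<S>. centered \<C>) \<and> pi_base X (\<Union>\<S>)"

text \<open>The choice below only selects a witness of least cardinality; by \<open>weak_density_attained\<close>
  and \<open>weak_density_least\<close> the result is the least cardinal of any index set (of any type) of
  centered families whose union is a \<open>\<pi>\<close>-base.\<close>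

definition weak_density :: "'a topology \<Rightarrow> 'a set set rel" where
  "weak_density X =
     |SOME \<S>. centered_pi_cover X \<S> \<and> (\<forall>\<T>. centered_pi_cover X \<T> \<longrightarrow> |\<S>| \<le>o |\<T>| )|"

lemma centered_pi_cover_exists: "\<exists>\<S>. centered_pi_cover X \<S>"
proof
  have "centered {U}" if "U \<noteq> {}" for U :: "'a set"
    using that unfolding centered_def by (metis cInf_singleton subset_singletonD)
  then show "centered_pi_cover X ((\<lambda>U. {U}) ` {U. openin X U \<and> U \<noteq> {}})"
    unfolding centered_pi_cover_def pi_base_def by auto
qed

lemma weak_density_attained:
  obtains \<S> where "centered_pi_cover X \<S>" "weak_density X = |\<S>|"
    "\<And>\<T>. centered_pi_cover X \<T> \<Longrightarrow> |\<S>| \<le>o |\<T>|"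
proof -
  let ?P = "\<lambda>\<S>. centered_pi_cover X \<S> \<and> (\<forall>\<T>. centered_pi_cover X \<T> \<longrightarrow> |\<S>| \<le>o |\<T>| )"
  let ?R = "card_of ` {\<S>. centered_pi_cover X \<S>}"
  have "?R \<noteq> {}"
    using centered_pi_cover_exists by blast
  moreover have "\<forall>r\<in>?R. Card_order r"
    by (auto simp: card_of_Card_order)
  ultimately have "\<exists>r\<in>?R. \<forall>r'\<in>?R. r \<le>o r'"
    by (rule exists_minim_Card_order)
  then have "\<exists>\<S>. ?P \<S>"
    by blast
  then have "?P (SOME \<S>. ?P \<S>)"
    by (rule someI_ex)
  then show thesis
    using that unfolding weak_density_def by blast
qed

lemma weak_density_least:
  assumes "\<And>i. i \<in> I \<Longrightarrow> centered (C i)" "pi_base X (\<Union>i\<in>I. C i)"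
  shows "weak_density X \<le>o |I|"
proof -
  have "centered_pi_cover X (C ` I)"
    using assms unfolding centered_pi_cover_def by auto
  then have "weak_density X \<le>o |C ` I|"
    by (metis weak_density_attained)
  then show ?thesis
    using card_of_image ordLeq_transitive by blast
qed


section \<open>Continuous functions and order-preserving functionals\<close>

text \<open>Functions on a space are represented as extensional functions on its carrier, so that
  equality in \<open>creal K\<close> is equality of continuous functions on \<open>K\<close>; likewise functionals
  are extensional on \<open>creal K\<close>.\<close>

definition creal :: "'b topology \<Rightarrow> ('b \<Rightarrow> real) set" where
  "creal K = {\<phi> \<in> extensional (topspace K). continuous_map K euclideanreal \<phi>}"

definition const_on :: "'b topology \<Rightarrow> real \<Rightarrow> 'b \<Rightarrow> real" where
  "const_on K c = (\<lambda>x\<in>topspace K. c)"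

definition order_preserving :: "'b topology \<Rightarrow> (('b \<Rightarrow> real) \<Rightarrow> real) \<Rightarrow> bool" where
  "order_preserving K \<mu> \<longleftrightarrow>
     (\<forall>\<phi>\<in>creal K. \<forall>\<psi>\<in>creal K. (\<forall>x\<in>topspace K. \<phi> x \<le> \<psi> x) \<longrightarrow> \<mu> \<phi> \<le> \<mu> \<psi>)"

definition weakly_additive :: "'b topology \<Rightarrow> (('b \<Rightarrow> real) \<Rightarrow> real) \<Rightarrow> bool" where
  "weakly_additive K \<mu> \<longleftrightarrow>
     (\<forall>\<phi>\<in>creal K. \<forall>c. \<mu> (\<lambda>x\<in>topspace K. \<phi> x + const_on K c x) = \<mu> \<phi> + c * \<mu> (const_on K 1))"

definition normed :: "'b topology \<Rightarrow> (('b \<Rightarrow> real) \<Rightarrow> real) \<Rightarrow> bool" where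
  "normed K \<mu> \<longleftrightarrow> \<mu> (const_on K 1) = 1"

definition O_set :: "'b topology \<Rightarrow> (('b \<Rightarrow> real) \<Rightarrow> real) set" where
  "O_set K = {\<mu> \<in> extensional (creal K).
     order_preserving K \<mu> \<and> weakly_additive K \<mu> \<and> normed K \<mu>}"

definition pointwise_topology ::
    "'b topology \<Rightarrow> (('b \<Rightarrow> real) \<Rightarrow> real) set \<Rightarrow> (('b \<Rightarrow> real) \<Rightarrow> real) topology" where
  "pointwise_topology K M = subtopology (product_topology (\<lambda>_. euclideanreal) (creal K)) M"

definition supported_on :: "'b topology \<Rightarrow> 'b set \<Rightarrow> (('b \<Rightarrow> real) \<Rightarrow> real) \<Rightarrow> bool" where
  "supported_on K A \<mu> \<longleftrightarrow>
     (\<exists>\<nu>\<in>O_set (subtopology K A). \<forall>\<phi>\<in>creal K. \<mu> \<phi> = \<nu> (restrict \<phi> A))"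

definition supp :: "'b topology \<Rightarrow> (('b \<Rightarrow> real) \<Rightarrow> real) \<Rightarrow> 'b set" where
  "supp K \<mu> = \<Inter>{A. closedin K A \<and> supported_on K A \<mu>}"


section \<open>The Stone-Cech compactification\<close>

definition Tychonoff_space :: "'a topology \<Rightarrow> bool" where
  "Tychonoff_space X \<longleftrightarrow> completely_regular_space X \<and> Hausdorff_space X"

text \<open>The closure of the image of \<open>X\<close> under the evaluation map into the cube whose coordinates
  are the continuous functions from \<open>X\<close> to the unit interval.\<close>

type_synonym 'a beta = "('a \<Rightarrow> real) \<Rightarrow> real"

definition cunit :: "'a topology \<Rightarrow> ('a \<Rightarrow> real) set" where
  "cunit X = {f \<in> creal X. f ` topspace X \<subseteq> {0..1}}"

definition cube :: "'a topology \<Rightarrow> 'a beta topology" where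
  "cube X = product_topology (\<lambda>_. top_of_set {0..1}) (cunit X)"

definition beta_emb :: "'a topology \<Rightarrow> 'a \<Rightarrow> 'a beta" where
  "beta_emb X x = (\<lambda>f\<in>cunit X. f x)"

definition Stone_Cech :: "'a topology \<Rightarrow> 'a beta topology" where
  "Stone_Cech X = subtopology (cube X) (cube X closure_of (beta_emb X ` topspace X))"

lemma beta_emb_in_cube: "x \<in> topspace X \<Longrightarrow> beta_emb X x \<in> topspace (cube X)"
  by (auto simp: cube_def beta_emb_def cunit_def)

lemma topspace_Stone_Cech: 
  "topspace (Stone_Cech X) = cube X closure_of (beta_emb X ` topspace X)"
  by (simp add: Stone_Cech_def closure_of_subset_topspace inf.absorb2)

lemma beta_emb_in_Stone_Cech: "beta_emb X ` topspace X \<subseteq> topspace (Stone_Cech X)"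
  unfolding topspace_Stone_Cech by (rule closure_of_subset) (auto simp: beta_emb_in_cube)

lemma Stone_Cech_dense:
  "Stone_Cech X closure_of (beta_emb X ` topspace X) = topspace (Stone_Cech X)"
  using beta_emb_in_Stone_Cech[of X] topspace_Stone_Cech[of X]
  unfolding Stone_Cech_def by (simp add: closure_of_subtopology inf.absorb2)

lemma compact_space_cube: "compact_space (cube X)"
  by (simp add: cube_def compact_space_product_topology compact_space_subtopology)

lemma Hausdorff_space_cube: "Hausdorff_space (cube X)"
  by (simp add: cube_def Hausdorff_space_product_topology Hausdorff_space_subtopology)

lemma compact_space_Stone_Cech: "compact_space (Stone_Cech X)"
  unfolding Stone_Cech_def
  by (simp add: closedin_compact_space compact_space_cube compact_space_subtopology)

lemma Hausdorff_space_Stone_Cech: "Hausdorff_space (Stone_Cech X)"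
  unfolding Stone_Cech_def by (simp add: Hausdorff_space_cube Hausdorff_space_subtopology)

lemma embedding_map_beta_emb_cube:
  assumes "Tychonoff_space X"
  shows "embedding_map X (cube X) (beta_emb X)"
proof -
  have "bounded (f ` topspace X)" if "f ` topspace X \<subseteq> {0..1}" for f :: "'a \<Rightarrow> real"
    using that bounded_closed_interval bounded_subset by blast
  then have "mspace (submetric (cfunspace X euclidean_metric) {f. f \<in> topspace X \<rightarrow> {0..1}}) = cunit X"
    by (auto simp: cunit_def creal_def extensional_def)
  moreover have "completely_regular_space X" "Hausdorff_space X"
    using assms by (auto simp: Tychonoff_space_def)
  ultimately show ?thesis
    using completely_regular_space_cube_embedding_explicit[of X]
    unfolding cube_def beta_emb_def[abs_def] by simp
qed

lemma embedding_map_beta_emb: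
  assumes "Tychonoff_space X"
  shows "embedding_map X (Stone_Cech X) (beta_emb X)"
  unfolding Stone_Cech_def embedding_map_in_subtopology
  using embedding_map_beta_emb_cube[OF assms] beta_emb_in_Stone_Cech[of X]
  unfolding topspace_Stone_Cech by (rule conjI)

lemma Stone_Cech_extension:
  assumes g: "continuous_map X Y g" and Y: "compact_space Y" "Hausdorff_space Y"
  obtains h where "continuous_map (Stone_Cech X) Y h"
    "\<And>x. x \<in> topspace X \<Longrightarrow> h (beta_emb X x) = g x"
proof -
  have tych: "Tychonoff_space Y"
    using Y by (simp add: Tychonoff_space_def compact_Hausdorff_or_regular_imp_normal_space
        normal_imp_completely_regular_space)
  let ?e = "beta_emb Y" and ?S = "beta_emb Y ` topspace Y"
  have hom: "homeomorphic_map Y (subtopology (cube Y) ?S) ?e"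
    using embedding_map_beta_emb_cube[OF tych] unfolding embedding_map_def .
  then obtain r where r: "homeomorphic_maps Y (subtopology (cube Y) ?S) ?e r"
    unfolding homeomorphic_map_maps by blast
  have pull: "restrict (f \<circ> g) (topspace X) \<in> cunit X" if "f \<in> cunit Y" for f
  proof -
    have "continuous_map X euclideanreal (f \<circ> g)"
      using that g continuous_map_compose unfolding cunit_def creal_def by blast
    then have "continuous_map X euclideanreal (restrict (f \<circ> g) (topspace X))"
      by (rule continuous_map_eq) auto
    moreover have "g ` topspace X \<subseteq> topspace Y"
      using g by (simp add: continuous_map_image_subset_topspace)
    ultimately show ?thesis
      using that unfolding cunit_def creal_def by auto
  qed
  define G where "G p = (\<lambda>f\<in>cunit Y. p (restrict (f \<circ> g) (topspace X)))" for p :: "'a beta"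
  have contG: "continuous_map (cube X) (cube Y) G"
    unfolding cube_def continuous_map_componentwise
  proof (intro conjI ballI)
    show "G ` topspace (product_topology (\<lambda>_. top_of_set {0..1}) (cunit X)) \<subseteq> extensional (cunit Y)"
      by (auto simp: G_def)
    fix f assume f: "f \<in> cunit Y"
    show "continuous_map (product_topology (\<lambda>_. top_of_set {0..1}) (cunit X)) (top_of_set {0..1})
            (\<lambda>p. G p f)"
      using continuous_map_product_projection[OF pull[OF f], of "\<lambda>_. top_of_set {0..1}"] f
      by (simp add: G_def)
  qed
  have Ge: "G (beta_emb X x) = ?e (g x)" if "x \<in> topspace X" for x
    using that pull by (auto simp: G_def beta_emb_def)
  have "compactin (cube Y) ?S"
  proof (rule image_compactin)
    show "compactin Y (topspace Y)"
      using Y(1) by (simp add: compact_space_def)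
    show "continuous_map Y (cube Y) ?e"
      using homeomorphic_imp_continuous_map[OF hom] unfolding continuous_map_in_subtopology by (rule conjunct1)
  qed
  then have closed: "closedin (cube Y) ?S"
    by (simp add: Hausdorff_space_cube compactin_imp_closedin)
  have "G ` topspace (Stone_Cech X) \<subseteq> cube Y closure_of (G ` (beta_emb X ` topspace X))"
    unfolding topspace_Stone_Cech using contG by (simp add: continuous_map_image_closure_subset)
  also have "\<dots> \<subseteq> ?S"
    using closed Ge g continuous_map_image_subset_topspace[OF g] 
    by (intro closure_of_minimal) auto
  finally have "continuous_map (Stone_Cech X) (subtopology (cube Y) ?S) G"
    using contG continuous_map_from_subtopology
    by (auto simp: continuous_map_in_subtopology Stone_Cech_def)
  then have "continuous_map (Stone_Cech X) Y (r \<circ> G)"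
    using r unfolding homeomorphic_maps_def by (meson continuous_map_compose)
  moreover have "(r \<circ> G) (beta_emb X x) = g x" if "x \<in> topspace X" for x
    using that r Ge continuous_map_image_subset_topspace[OF g]
    by (auto simp: homeomorphic_maps_def)
  ultimately show thesis
    by (rule that)
qed


section \<open>Nets\<close>

definition directed :: "'i set \<Rightarrow> ('i \<Rightarrow> 'i \<Rightarrow> bool) \<Rightarrow> bool" where
  "directed D le \<longleftrightarrow> D \<noteq> {} \<and> (\<forall>a\<in>D. le a a) \<and>
     (\<forall>a\<in>D. \<forall>b\<in>D. \<forall>c\<in>D. le a b \<and> le b c \<longrightarrow> le a c) \<and>
     (\<forall>a\<in>D. \<forall>b\<in>D. \<exists>c\<in>D. le a c \<and> le b c)"

lemma directed_bound:
  assumes "directed D le" "a \<in> D" "b \<in> D"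
  obtains c where "c \<in> D" "le a c" "le b c"
  using assms unfolding directed_def by meson

lemma directed_trans:
  "directed D le \<Longrightarrow> a \<in> D \<Longrightarrow> b \<in> D \<Longrightarrow> c \<in> D \<Longrightarrow> le a b \<Longrightarrow> le b c \<Longrightarrow> le a c"
  unfolding directed_def by meson

lemma directed_refl: "directed D le \<Longrightarrow> a \<in> D \<Longrightarrow> le a a"
  unfolding directed_def by meson

definition tails :: "'i set \<Rightarrow> ('i \<Rightarrow> 'i \<Rightarrow> bool) \<Rightarrow> 'i filter" where
  "tails D le = (INF a\<in>D. principal {b\<in>D. le a b})"

lemma eventually_tails:
  assumes "directed D le"
  shows "eventually P (tails D le) \<longleftrightarrow> (\<exists>a\<in>D. \<forall>b\<in>D. le a b \<longrightarrow> P b)"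
proof -
  have "\<exists>c\<in>D. principal {b\<in>D. le c b} \<le> inf (principal {d\<in>D. le a d}) (principal {d\<in>D. le b d})"
    if ab: "a \<in> D" "b \<in> D" for a b
  proof -
    obtain c where "c \<in> D" "le a c" "le b c"
      using directed_bound[OF assms ab] by blast
    moreover have "{d\<in>D. le c d} \<subseteq> {d\<in>D. le a d} \<inter> {d\<in>D. le b d}"
      using directed_trans[OF assms] ab calculation by blast
    ultimately show ?thesis
      by auto
  qed
  moreover have "D \<noteq> {}"
    using assms by (simp add: directed_def)
  ultimately show ?thesis
    unfolding tails_def by (subst eventually_INF_base) (auto simp: eventually_principal)
qed


section \<open>The functionals on a Tychonoff space\<close>

text \<open>Nets in \<open>creal (Stone_Cech X)\<close> are indexed by directed sets of the fixed type
  \<open>('a beta \<Rightarrow> real) set\<close>. This is no restriction: see \<open>tau_smooth_net\<close> and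
  \<open>Radon_net\<close>, where the index type is arbitrary.\<close>

definition decreasing_to_zero ::
    "'a topology \<Rightarrow> 'i set \<Rightarrow> ('i \<Rightarrow> 'i \<Rightarrow> bool) \<Rightarrow> ('i \<Rightarrow> 'a beta \<Rightarrow> real) \<Rightarrow> bool" where
  "decreasing_to_zero X D le \<phi> \<longleftrightarrow>
     (\<forall>x\<in>topspace X.
        (\<forall>a\<in>D. \<forall>b\<in>D. le a b \<longrightarrow> \<phi> b (beta_emb X x) \<le> \<phi> a (beta_emb X x)) \<and>
        ((\<lambda>a. \<phi> a (beta_emb X x)) \<longlongrightarrow> 0) (tails D le))"

definition bounded_net ::
    "'b topology \<Rightarrow> 'i set \<Rightarrow> ('i \<Rightarrow> 'b \<Rightarrow> real) \<Rightarrow> bool" where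
  "bounded_net K D \<phi> \<longleftrightarrow> (\<exists>M. \<forall>a\<in>D. \<forall>p\<in>topspace K. \<bar>\<phi> a p\<bar> \<le> M)"

definition zero_on_compacts ::
    "'a topology \<Rightarrow> 'i set \<Rightarrow> ('i \<Rightarrow> 'i \<Rightarrow> bool) \<Rightarrow> ('i \<Rightarrow> 'a beta \<Rightarrow> real) \<Rightarrow> bool" where
  "zero_on_compacts X D le \<phi> \<longleftrightarrow>
     (\<forall>C. compactin X C \<longrightarrow> uniform_limit (beta_emb X ` C) \<phi> (\<lambda>_. 0) (tails D le))"

definition tau_smooth :: "'a topology \<Rightarrow> (('a beta \<Rightarrow> real) \<Rightarrow> real) \<Rightarrow> bool" where
  "tau_smooth X \<mu> \<longleftrightarrow>
     (\<forall>(D :: ('a beta \<Rightarrow> real) set set) le \<phi>.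
        directed D le \<and> \<phi> ` D \<subseteq> creal (Stone_Cech X) \<and> decreasing_to_zero X D le \<phi>
        \<longrightarrow> ((\<lambda>a. \<mu> (\<phi> a)) \<longlongrightarrow> 0) (tails D le))"

definition Radon :: "'a topology \<Rightarrow> (('a beta \<Rightarrow> real) \<Rightarrow> real) \<Rightarrow> bool" where
  "Radon X \<mu> \<longleftrightarrow>
     (\<forall>(D :: ('a beta \<Rightarrow> real) set set) le \<phi>.
        directed D le \<and> \<phi> ` D \<subseteq> creal (Stone_Cech X) \<and>
        bounded_net (Stone_Cech X) D \<phi> \<and> zero_on_compacts X D le \<phi>
        \<longrightarrow> ((\<lambda>a. \<mu> (\<phi> a)) \<longlongrightarrow> 0) (tails D le))"

lemma tau_smooth_net:
  fixes D :: "'i set"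
  assumes "tau_smooth X \<mu>" and dir: "directed D le"
    and C: "\<phi> ` D \<subseteq> creal (Stone_Cech X)" and dec: "decreasing_to_zero X D le \<phi>"
  shows "((\<lambda>a. \<mu> (\<phi> a)) \<longlongrightarrow> 0) (tails D le)"
proof -
  let ?e = "beta_emb X"
  define E where "E = (\<lambda>a. {\<phi> a}) ` D"
  define le' where "le' S T \<longleftrightarrow> (\<forall>x\<in>topspace X. the_elem T (?e x) \<le> the_elem S (?e x))"
    for S T :: "('a beta \<Rightarrow> real) set"
  have le'_refl: "le' S S" for S
    by (simp add: le'_def)
  have le'_trans: "le' S U" if "le' S T" "le' T U" for S T U
    unfolding le'_def
  proof
    fix x assume "x \<in> topspace X"
    then have "the_elem U (?e x) \<le> the_elem T (?e x)" "the_elem T (?e x) \<le> the_elem S (?e x)"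
      using that by (auto simp: le'_def)
    then show "the_elem U (?e x) \<le> the_elem S (?e x)"
      by simp
  qed
  have mono: "\<phi> b (?e x) \<le> \<phi> a (?e x)" if "a \<in> D" "b \<in> D" "le a b" "x \<in> topspace X" for a b x
    using dec that unfolding decreasing_to_zero_def by blast
  have small: "\<exists>a\<in>D. \<forall>b\<in>D. le a b \<longrightarrow> \<bar>\<phi> b (?e x)\<bar> < \<epsilon>" if "x \<in> topspace X" "\<epsilon> > 0" for x \<epsilon>
    using dec that unfolding decreasing_to_zero_def tendsto_iff eventually_tails[OF dir] by auto
  have nonneg: "\<phi> b (?e x) \<ge> 0" if bx: "b \<in> D" "x \<in> topspace X" for b x
  proof (rule ccontr)
    assume "\<not> \<phi> b (?e x) \<ge> 0"
    then obtain a where a: "a \<in> D" "\<forall>c\<in>D. le a c \<longrightarrow> \<bar>\<phi> c (?e x)\<bar> < - \<phi> b (?e x)"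
      using small[OF bx(2), of "- \<phi> b (?e x)"] by (meson neg_0_less_iff_less not_le)
    obtain c where "c \<in> D" "le a c" "le b c"
      using directed_bound[OF dir \<open>a \<in> D\<close> bx(1)] by blast
    then show False
      using a mono[of b c x] bx by force
  qed
  have dir': "directed E le'"
    unfolding directed_def
  proof (intro conjI ballI)
    show "E \<noteq> {}"
      using dir by (simp add: E_def directed_def)
    fix S T assume "S \<in> E" "T \<in> E"
    then obtain a b where "S = {\<phi> a}" "T = {\<phi> b}" "a \<in> D" "b \<in> D"
      by (auto simp: E_def)
    moreover obtain c where "c \<in> D" "le a c" "le b c"
      using directed_bound[OF dir] calculation by blast
    ultimately have "{\<phi> c} \<in> E" "le' S {\<phi> c}" "le' T {\<phi> c}"
      using mono by (auto simp: E_def le'_def)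
    then show "\<exists>U\<in>E. le' S U \<and> le' T U" by blast
  qed (blast intro: le'_refl le'_trans)+
  have "decreasing_to_zero X E le' the_elem"
    unfolding decreasing_to_zero_def
  proof (intro ballI conjI impI)
    fix x assume x: "x \<in> topspace X"
    show "((\<lambda>S. the_elem S (?e x)) \<longlongrightarrow> 0) (tails E le')"
      unfolding tendsto_iff eventually_tails[OF dir']
    proof (intro allI impI)
      fix \<epsilon> :: real assume "\<epsilon> > 0"
      then obtain a where a: "a \<in> D" "\<bar>\<phi> a (?e x)\<bar> < \<epsilon>"
        using small[OF x] directed_refl[OF dir] by blast
      have "dist (the_elem T (?e x)) 0 < \<epsilon>" if "T \<in> E" "le' {\<phi> a} T" for T
        using that a x nonneg by (force simp: E_def le'_def)
      then show "\<exists>S\<in>E. \<forall>T\<in>E. le' S T \<longrightarrow> dist (the_elem T (?e x)) 0 < \<epsilon>"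
        using a(1) unfolding E_def by blast
    qed
  qed (auto simp: le'_def)
  moreover have "the_elem ` E \<subseteq> creal (Stone_Cech X)"
    using C by (auto simp: E_def)
  ultimately have lim: "((\<lambda>S. \<mu> (the_elem S)) \<longlongrightarrow> 0) (tails E le')"
    using assms(1) dir' unfolding tau_smooth_def by blast
  show ?thesis
    unfolding tendsto_iff eventually_tails[OF dir]
  proof (intro allI impI)
    fix \<epsilon> :: real assume "\<epsilon> > 0"
    then obtain a where a: "a \<in> D" "\<forall>T\<in>E. le' {\<phi> a} T \<longrightarrow> dist (\<mu> (the_elem T)) 0 < \<epsilon>"
      using lim unfolding tendsto_iff eventually_tails[OF dir'] by (auto simp: E_def)
    have "dist (\<mu> (\<phi> b)) 0 < \<epsilon>" if "b \<in> D" "le a b" for b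
      using a that mono by (force simp: E_def le'_def)
    then show "\<exists>a\<in>D. \<forall>b\<in>D. le a b \<longrightarrow> dist (\<mu> (\<phi> b)) 0 < \<epsilon>"
      using a by blast
  qed
qed

lemma Radon_net:
  fixes D :: "'i set"
  assumes "Radon X \<mu>" and dir: "directed D le"
    and C: "\<phi> ` D \<subseteq> creal (Stone_Cech X)"
    and bdd: "bounded_net (Stone_Cech X) D \<phi>" and zero: "zero_on_compacts X D le \<phi>"
  shows "((\<lambda>a. \<mu> (\<phi> a)) \<longlongrightarrow> 0) (tails D le)"
proof (rule ccontr)
  assume "\<not> ?thesis"
  then obtain \<epsilon> where \<epsilon>: "\<epsilon> > 0" and freq: "\<And>a. a \<in> D \<Longrightarrow> \<exists>b\<in>D. le a b \<and> \<bar>\<mu> (\<phi> b)\<bar> \<ge> \<epsilon>"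
    unfolding tendsto_iff eventually_tails[OF dir] by (auto simp: not_less)
  define E where "E = {S. eventually (\<lambda>a. \<phi> a \<in> S) (tails D le)}"
  define le' where "le' S T \<longleftrightarrow> T \<subseteq> S" for S T :: "('a beta \<Rightarrow> real) set"
  have "\<exists>b\<in>D. \<phi> b \<in> S \<and> \<bar>\<mu> (\<phi> b)\<bar> \<ge> \<epsilon>" if "S \<in> E" for S
    using that freq unfolding E_def eventually_tails[OF dir] by blast
  then obtain s where s: "\<And>S. S \<in> E \<Longrightarrow> s S \<in> D \<and> \<phi> (s S) \<in> S \<and> \<bar>\<mu> (\<phi> (s S))\<bar> \<ge> \<epsilon>"
    by metis
  have UNIV: "UNIV \<in> E"
    by (simp add: E_def)
  have dir': "directed E le'"
    unfolding directed_def
  proof (intro conjI ballI)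
    fix S T assume "S \<in> E" "T \<in> E"
    then have "S \<inter> T \<in> E"
      by (simp add: E_def eventually_conj)
    then show "\<exists>U\<in>E. le' S U \<and> le' T U"
      unfolding le'_def by blast
  qed (use UNIV in \<open>auto simp: le'_def\<close>)
  have "zero_on_compacts X E le' (\<phi> \<circ> s)"
    unfolding zero_on_compacts_def
  proof (intro allI impI)
    fix C assume C: "compactin X C"
    show "uniform_limit (beta_emb X ` C) (\<phi> \<circ> s) (\<lambda>_. 0) (tails E le')"
      unfolding uniform_limit_iff eventually_tails[OF dir']
    proof (intro allI impI)
      fix \<eta> :: real assume "\<eta> > 0"
      let ?S = "{f. \<forall>p\<in>beta_emb X ` C. dist (f p) 0 < \<eta>}"
      have "?S \<in> E"
        using zero C \<open>\<eta> > 0\<close> unfolding zero_on_compacts_def uniform_limit_iff E_def by simp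
      then show "\<exists>S\<in>E. \<forall>T\<in>E. le' S T \<longrightarrow> (\<forall>p\<in>beta_emb X ` C. dist ((\<phi> \<circ> s) T p) 0 < \<eta>)"
        using s unfolding le'_def by (intro bexI[of _ ?S]) auto
    qed
  qed
  moreover have "bounded_net (Stone_Cech X) E (\<phi> \<circ> s)"
    using bdd s unfolding bounded_net_def by (metis comp_apply)
  moreover have "(\<phi> \<circ> s) ` E \<subseteq> creal (Stone_Cech X)"
    using C s by auto
  ultimately have "((\<lambda>S. \<mu> ((\<phi> \<circ> s) S)) \<longlongrightarrow> 0) (tails E le')"
    using assms(1) dir' unfolding Radon_def by blast
  then obtain S where "S \<in> E" "\<forall>T\<in>E. le' S T \<longrightarrow> dist (\<mu> (\<phi> (s T))) 0 < \<epsilon>"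
    using \<epsilon> unfolding tendsto_iff eventually_tails[OF dir'] by auto
  then have "\<bar>\<mu> (\<phi> (s S))\<bar> < \<epsilon>"
    by (auto simp: le'_def)
  with s[OF \<open>S \<in> E\<close>] show False
    by simp
qed

definition O_tau_set :: "'a topology \<Rightarrow> (('a beta \<Rightarrow> real) \<Rightarrow> real) set" where
  "O_tau_set X = {\<mu> \<in> O_set (Stone_Cech X). tau_smooth X \<mu>}"

definition O_R_set :: "'a topology \<Rightarrow> (('a beta \<Rightarrow> real) \<Rightarrow> real) set" where
  "O_R_set X = {\<mu> \<in> O_set (Stone_Cech X). Radon X \<mu>}"

definition O_beta_set :: "'a topology \<Rightarrow> (('a beta \<Rightarrow> real) \<Rightarrow> real) set" where
  "O_beta_set X = {\<mu> \<in> O_set (Stone_Cech X). supp (Stone_Cech X) \<mu> \<subseteq> beta_emb X ` topspace X}"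

definition O_space :: "'b topology \<Rightarrow> (('b \<Rightarrow> real) \<Rightarrow> real) topology" where
  "O_space K = pointwise_topology K (O_set K)"

definition O_tau :: "'a topology \<Rightarrow> (('a beta \<Rightarrow> real) \<Rightarrow> real) topology" where
  "O_tau X = pointwise_topology (Stone_Cech X) (O_tau_set X)"

definition O_R :: "'a topology \<Rightarrow> (('a beta \<Rightarrow> real) \<Rightarrow> real) topology" where
  "O_R X = pointwise_topology (Stone_Cech X) (O_R_set X)"

definition O_beta :: "'a topology \<Rightarrow> (('a beta \<Rightarrow> real) \<Rightarrow> real) topology" where
  "O_beta X = pointwise_topology (Stone_Cech X) (O_beta_set X)"

end

theory Submission
  imports Defs "HOL-Algebra.Free_Abelian_Groups"
begin

text \<open>
  Let \<open>\<tau>\<close> be the weak density of \<open>X\<close> and \<open>K = \<beta>X\<close>. Everything reduces to density of two kinds of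
  subsets. If \<open>E\<close> and \<open>M\<close> are dense in a space \<open>Y\<close>, then the traces on \<open>M\<close> of the open
  neighbourhoods of a point \<open>e \<in> E\<close> form a centered family, and these families exhaust the nonempty
  open sets of \<open>M\<close>; so the weak density of \<open>M\<close> is at most the cardinality of \<open>E\<close>
  (\<open>weak_density_dense_subspace_le\<close>). It is applied with \<open>Y = O(K)\<close> and \<open>M\<close> any of the four spaces.

  Both dense sets consist of functionals
  \<open>\<phi> \<mapsto> max\<^sub>T min\<^bsub>(p,r)\<in>T\<^esub> (\<phi> p + r)\<close>, shifted so as to vanish at \<open>0\<close>, where \<open>T\<close> runs over a finite family
  of finite sets of pairs of a point \<open>p\<close> and a rational \<open>r\<close>. They are order-preserving and commute
  with adding constants. If the points range over a dense set \<open>D \<subseteq> K\<close>, these functionals are dense in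
  \<open>O(K)\<close> (\<open>max_min_functionals_dense\<close>): an order-preserving weakly additive \<open>\<mu>\<close> satisfies
  \<open>\<mu> \<phi> - \<mu> \<psi> \<le> sup (\<phi> - \<psi>)\<close>, so for each pair \<open>\<phi>, \<psi>\<close> from a finite set there is a point \<open>p \<in> D\<close> where
  \<open>\<phi> - \<psi>\<close> nearly reaches \<open>\<mu> \<phi> - \<mu> \<psi>\<close>, and these points determine a max-min expression close to \<open>\<mu>\<close>
  on that finite set.

  To get a small \<open>E\<close>, choose for each centered family of a \<open>\<pi>\<close>-base of \<open>X\<close> a common point in \<open>K\<close> of
  the closures of its members; by regularity of \<open>K\<close> these points form a dense set \<open>D\<close> of cardinality
  at most \<open>\<tau>\<close> (\<open>centered_pi_cover_dense_set\<close>). Since \<open>X\<close> is infinite, so is \<open>D\<close>, hence \<open>\<tau>\<close> is infinite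
  and there are at most \<open>\<tau>\<close> max-min functionals over \<open>D\<close>. To see that \<open>M\<close> is dense, take the points
  in \<open>X\<close> itself: a functional depending on finitely many points of \<open>X\<close> is \<open>\<tau>\<close>-smooth, Radon, and
  supported in \<open>X\<close>.
\<close>

(* Both symbols would clash with topological closure and with equality of cardinals. *)
no_notation eq_closure_of (\<open>closure'_of\<index>\<close>)
no_notation elt_set_eq (infix \<open>=o\<close> 50)

section \<open>Weak density and dense sets\<close>

lemma weak_density_dense_subspace_le:
  assumes E: "Y closure_of E = topspace Y" and M: "Y closure_of M = topspace Y"
  shows "weak_density (subtopology Y M) \<le>o |E|"
proof -
  define C where "C e = {V \<inter> M |V. openin Y V \<and> e \<in> V}" for e
  have meets: "E \<inter> V \<noteq> {}" "M \<inter> V \<noteq> {}" if "openin Y V" "V \<noteq> {}" for V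
    using that E M dense_intersects_open by metis+
  have "centered (C e)" for e
    unfolding centered_def
  proof (intro allI impI, elim conjE)
    fix \<F> assume "finite \<F>" "\<F> \<subseteq> C e" "\<F> \<noteq> {}"
    from this(1,3,2) have "\<exists>V. openin Y V \<and> e \<in> V \<and> \<Inter>\<F> = V \<inter> M"
    proof (induction rule: finite_ne_induct)
      case (singleton B)
      then show ?case by (auto simp: C_def)
    next
      case (insert B \<F>)
      then obtain V where V: "openin Y V" "e \<in> V" "\<Inter>\<F> = V \<inter> M"
        by auto
      obtain W where W: "openin Y W" "e \<in> W" "B = W \<inter> M"
        using insert by (auto simp: C_def)
      have "\<Inter>(insert B \<F>) = (W \<inter> V) \<inter> M"
        unfolding Inter_insert V(3) W(3) by blast
      with V W show ?case
        by blast
    qed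
    then obtain V where V: "openin Y V" "e \<in> V" "\<Inter>\<F> = V \<inter> M"
      by auto
    then show "\<Inter>\<F> \<noteq> {}"
      using meets(2)[of V] by (simp add: Int_commute) auto
  qed
  moreover have "pi_base (subtopology Y M) (\<Union>e\<in>E. C e)"
    unfolding pi_base_def
  proof (intro conjI allI impI ballI)
    fix B assume "B \<in> (\<Union>e\<in>E. C e)"
    then obtain V e where V: "openin Y V" "e \<in> V" "B = V \<inter> M"
      by (auto simp: C_def)
    then show "openin (subtopology Y M) B"
      by (auto simp: openin_subtopology)
    show "B \<noteq> {}"
      using V meets(2)[of V] by blast
  next
    fix U assume "openin (subtopology Y M) U \<and> U \<noteq> {}"
    then obtain V where V: "openin Y V" "U = V \<inter> M" "V \<noteq> {}"
      by (auto simp: openin_subtopology)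
    then obtain e where "e \<in> E" "e \<in> V"
      using meets(1) by blast
    with V show "\<exists>B\<in>\<Union>e\<in>E. C e. B \<subseteq> U"
      by (auto simp: C_def)
  qed
  ultimately show ?thesis
    using weak_density_least[of E C "subtopology Y M"] by simp
qed

text \<open>By compactness the closures of the images of the members of a centered family have a common
  point. Every nonempty open set of \<open>K\<close> contains such a closure, because \<open>K\<close> is regular and the
  preimage of a smaller open set contains a member of the \<open>\<pi>\<close>-base.\<close>

lemma centered_pi_cover_dense_set:
  assumes S: "centered_pi_cover X \<S>"
    and K: "compact_space K" "Hausdorff_space K"
    and e: "continuous_map X K e" "K closure_of (e ` topspace X) = topspace K"
  obtains D where "D \<subseteq> topspace K" "K closure_of D = topspace K" "|D| \<le>o |\<S>|"
proof -
  have open_nonempty: "openin X U" "U \<noteq> {}" if "U \<in> \<C>" "\<C> \<in> \<S>" for U \<C>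
    using S that unfolding centered_pi_cover_def pi_base_def by auto
  have "\<exists>q. \<forall>U\<in>\<C>. q \<in> K closure_of (e ` U)" if C: "\<C> \<in> \<S>" for \<C>
  proof -
    let ?U = "(\<lambda>U. K closure_of (e ` U)) ` \<C>"
    have "\<Inter>\<F> \<noteq> {}" if F: "finite \<F>" "\<F> \<subseteq> ?U" for \<F>
    proof (cases "\<F> = {}")
      case False
      obtain \<G> where G: "\<G> \<subseteq> \<C>" "finite \<G>" "\<F> = (\<lambda>U. K closure_of (e ` U)) ` \<G>"
        using F finite_subset_image by metis
      then have "\<G> \<noteq> {}" using False by auto
      moreover have "centered \<C>"
        using S C unfolding centered_pi_cover_def by blast
      ultimately obtain x where x: "x \<in> \<Inter>\<G>"
        using G unfolding centered_def by blast
      have "e x \<in> K closure_of (e ` U)" if "U \<in> \<G>" for U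
      proof -
        have "U \<subseteq> topspace X"
          using open_nonempty(1)[of U \<C>] that G C openin_subset by blast
        then have "e ` U \<subseteq> topspace K"
          using continuous_map_image_subset_topspace[OF e(1)] by blast
        then show ?thesis
          using x that closure_of_subset by blast
      qed
      then show ?thesis
        using G(3) by blast
    qed simp
    moreover have "\<forall>C\<in>?U. closedin K C"
      by simp
    ultimately have "\<Inter>?U \<noteq> {}"
      using K(1) unfolding compact_space_fip by meson
    then show ?thesis by blast
  qed
  then obtain q where q: "\<And>\<C> U. \<C> \<in> \<S> \<Longrightarrow> U \<in> \<C> \<Longrightarrow> q \<C> \<in> K closure_of (e ` U)"
    by metis
  define D where "D = q ` (\<S> - {{}})"
  have D: "D \<subseteq> topspace K"
  proof
    fix p assume "p \<in> D"
    then obtain \<C> U where "\<C> \<in> \<S>" "U \<in> \<C>" "p = q \<C>"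
      by (auto simp: D_def)
    then show "p \<in> topspace K"
      using q[of \<C> U] closure_of_subset_topspace[of K "e ` U"] by (simp add: subset_iff)
  qed
  have "D \<inter> V \<noteq> {}" if V: "openin K V" "V \<noteq> {}" for V
  proof -
    obtain v where v: "v \<in> V" using V by blast
    have "regular_space K"
      using K by (rule compact_Hausdorff_imp_regular_space)
    then obtain W F where W: "openin K W" "closedin K F" "v \<in> W" "W \<subseteq> F" "F \<subseteq> V"
      using V(1) v unfolding neighbourhood_base_of_closedin[symmetric] neighbourhood_base_of by meson
    let ?P = "{x \<in> topspace X. e x \<in> W}"
    have "openin X ?P"
      using e(1) W(1) by (rule openin_continuous_map_preimage)
    moreover have "?P \<noteq> {}"
      using e(2) W(1,3) unfolding dense_intersects_open by blast
    moreover have "pi_base X (\<Union>\<S>)"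
      using S by (simp add: centered_pi_cover_def)
    ultimately have "\<exists>U\<in>\<Union>\<S>. U \<subseteq> ?P"
      unfolding pi_base_def by simp
    then obtain \<C> U where U: "\<C> \<in> \<S>" "U \<in> \<C>" "U \<subseteq> ?P"
      by auto
    then have "e ` U \<subseteq> F"
      using W by blast
    then have "q \<C> \<in> V"
      using q[OF U(1,2)] closure_of_minimal[of "e ` U" F K] W(2,5) by blast
    moreover have "q \<C> \<in> D"
      using U by (auto simp: D_def)
    ultimately show ?thesis by blast
  qed
  then have "K closure_of D = topspace K"
    unfolding dense_intersects_open by blast
  moreover have "|D| \<le>o |\<S>|"
    unfolding D_def using card_of_image card_of_mono1 ordLeq_transitive by (metis Diff_subset)
  ultimately show thesis
    using D that by blast
qed

section \<open>Max-min functionals\<close>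

definition max_min :: "('b \<times> real) set set \<Rightarrow> ('b \<Rightarrow> real) \<Rightarrow> real" where
  "max_min L \<phi> = (MAX T\<in>L. MIN pr\<in>T. \<phi> (fst pr) + snd pr)"

definition max_min_index :: "'b set \<Rightarrow> ('b \<times> real) set set set" where
  "max_min_index D = {L \<in> Fpow (Fpow (D \<times> \<rat>)). L \<noteq> {} \<and> {} \<notin> L}"

definition nodes :: "('b \<times> real) set set \<Rightarrow> 'b set" where
  "nodes L = fst ` \<Union>L"

text \<open>The rational shifts that approximate a given functional make the value at \<open>0\<close> close to \<open>0\<close> but
  not necessarily equal to it; subtracting that value makes the functional normed.\<close>

definition max_min_functional :: "'b topology \<Rightarrow> ('b \<times> real) set set \<Rightarrow> ('b \<Rightarrow> real) \<Rightarrow> real" where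
  "max_min_functional K L = (\<lambda>\<phi>\<in>creal K. max_min L \<phi> - max_min L (\<lambda>_. 0))"

lemma max_min_indexD:
  assumes "L \<in> max_min_index D"
  shows "finite L" "L \<noteq> {}" "\<And>T. T \<in> L \<Longrightarrow> finite T" "\<And>T. T \<in> L \<Longrightarrow> T \<noteq> {}"
    "finite (nodes L)" "nodes L \<subseteq> D"
proof -
  show "finite L" "L \<noteq> {}" and *: "\<And>T. T \<in> L \<Longrightarrow> finite T" and "\<And>T. T \<in> L \<Longrightarrow> T \<noteq> {}"
    using assms by (auto simp: max_min_index_def Fpow_def)
  then show "finite (nodes L)"
    by (simp add: nodes_def)
  show "nodes L \<subseteq> D"
    using assms by (fastforce simp: max_min_index_def Fpow_def nodes_def)
qed

lemma max_min_le_shift: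
  assumes L: "L \<in> max_min_index D" and le: "\<And>p. p \<in> nodes L \<Longrightarrow> \<phi> p \<le> \<psi> p + c"
  shows "max_min L \<phi> \<le> max_min L \<psi> + c"
proof -
  note L = max_min_indexD[OF L]
  have "(MIN pr\<in>T. \<phi> (fst pr) + snd pr) \<le> max_min L \<psi> + c" if T: "T \<in> L" for T
  proof -
    have "(MIN pr\<in>T. \<psi> (fst pr) + snd pr) \<in> (\<lambda>pr. \<psi> (fst pr) + snd pr) ` T"
      using L(3,4)[OF T] by (intro Min_in) auto
    then obtain pr where pr: "pr \<in> T" "(MIN pr\<in>T. \<psi> (fst pr) + snd pr) = \<psi> (fst pr) + snd pr"
      by auto
    have "(MIN pr\<in>T. \<phi> (fst pr) + snd pr) \<le> \<phi> (fst pr) + snd pr"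
      using L(3)[OF T] pr(1) by simp
    also have "\<dots> \<le> \<psi> (fst pr) + snd pr + c"
      using le[of "fst pr"] pr(1) T by (force simp: nodes_def)
    also have "\<psi> (fst pr) + snd pr \<le> max_min L \<psi>"
      unfolding max_min_def pr(2)[symmetric] using L(1) T by simp
    finally show ?thesis by simp
  qed
  then show ?thesis
    unfolding max_min_def[of L \<phi>] using L(1,2) by simp
qed

lemma max_min_add_const_cong:
  assumes "L \<in> max_min_index D" and "\<And>p. p \<in> nodes L \<Longrightarrow> \<phi> p = \<psi> p + c"
  shows "max_min L \<phi> = max_min L \<psi> + c"
  using max_min_le_shift[of L D \<phi> \<psi> c] max_min_le_shift[of L D \<psi> \<phi> "- c"] assms by force

lemma max_min_functional_abs_le:
  assumes L: "L \<in> max_min_index D" and "\<phi> \<in> creal K" and small: "\<And>p. p \<in> nodes L \<Longrightarrow> \<bar>\<phi> p\<bar> \<le> \<epsilon>"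
  shows "\<bar>max_min_functional K L \<phi>\<bar> \<le> \<epsilon>"
proof -
  have "max_min L \<phi> \<le> max_min L (\<lambda>_. 0) + \<epsilon>"
    using small by (intro max_min_le_shift[OF L]) (simp add: abs_le_iff)
  moreover have "max_min L (\<lambda>_. 0) \<le> max_min L \<phi> + \<epsilon>"
    using small by (intro max_min_le_shift[OF L]) (fastforce simp: abs_le_iff)
  ultimately show ?thesis
    using assms(2) by (simp add: max_min_functional_def abs_le_iff)
qed

lemma creal_const: "const_on K c \<in> creal K"
proof -
  have "continuous_map K euclideanreal (const_on K c)"
    by (rule continuous_map_eq[of _ _ "\<lambda>_. c"]) (auto simp: const_on_def)
  then show ?thesis
    by (simp add: creal_def const_on_def)
qed

lemma creal_add_const:
  assumes "\<phi> \<in> creal K"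
  shows "(\<lambda>x\<in>topspace K. \<phi> x + const_on K c x) \<in> creal K"
proof -
  have "continuous_map K euclideanreal (\<lambda>x. \<phi> x + c)"
    using assms by (intro continuous_intros) (auto simp: creal_def)
  then have "continuous_map K euclideanreal (\<lambda>x\<in>topspace K. \<phi> x + const_on K c x)"
    by (rule continuous_map_eq) (auto simp: const_on_def)
  then show ?thesis
    by (simp add: creal_def)
qed

lemma max_min_functional_in_O_set:
  assumes L: "L \<in> max_min_index D" and D: "D \<subseteq> topspace K"
  shows "max_min_functional K L \<in> O_set K"
proof -
  have nodes: "p \<in> topspace K" if "p \<in> nodes L" for p
    using max_min_indexD(6)[OF L] D that by blast
  have "max_min L \<phi> \<le> max_min L \<psi>" if "\<forall>x\<in>topspace K. \<phi> x \<le> \<psi> x" for \<phi> \<psi>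
    using max_min_le_shift[OF L, of \<phi> \<psi> 0] that nodes by simp
  then have "order_preserving K (max_min_functional K L)"
    by (simp add: order_preserving_def max_min_functional_def)
  moreover have one: "normed K (max_min_functional K L)"
    using max_min_add_const_cong[OF L, of "const_on K 1" "\<lambda>_. 0" 1] nodes creal_const[of K 1]
    by (simp add: normed_def max_min_functional_def const_on_def)
  moreover have "weakly_additive K (max_min_functional K L)"
    unfolding weakly_additive_def
  proof (intro ballI allI)
    fix \<phi> c assume \<phi>: "\<phi> \<in> creal K"
    show "max_min_functional K L (\<lambda>x\<in>topspace K. \<phi> x + const_on K c x)
          = max_min_functional K L \<phi> + c * max_min_functional K L (const_on K 1)"
      using max_min_add_const_cong[OF L, of "\<lambda>x\<in>topspace K. \<phi> x + const_on K c x" \<phi> c] nodes one \<phi>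
        creal_add_const[OF \<phi>, of c]
      by (simp add: normed_def max_min_functional_def const_on_def)
  qed
  ultimately show ?thesis
    by (simp add: O_set_def max_min_functional_def)
qed

section \<open>Density of the max-min functionals\<close>

text \<open>The inequality \<open>\<mu> \<phi> - \<mu> \<psi> \<le> sup (\<phi> - \<psi>)\<close>, in the form needed for a dense set of points. If
  \<open>\<phi> - \<psi> \<le> c\<close> everywhere with \<open>c < \<mu> \<phi> - \<mu> \<psi>\<close>, then \<open>\<mu> \<phi> \<le> \<mu> (\<psi> + c) = \<mu> \<psi> + c\<close>, a contradiction; and
  the set where \<open>\<phi> - \<psi> > c\<close> is open.\<close>

lemma O_set_difference_nearly_attained:
  assumes \<mu>: "\<mu> \<in> O_set K" and \<phi>: "\<phi> \<in> creal K" and \<psi>: "\<psi> \<in> creal K"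
    and D: "K closure_of D = topspace K" and c: "c < \<mu> \<phi> - \<mu> \<psi>"
  obtains p where "p \<in> D" "c < \<phi> p - \<psi> p"
proof -
  let ?V = "{x \<in> topspace K. \<phi> x - \<psi> x \<in> {c<..}}"
  have "continuous_map K euclideanreal (\<lambda>x. \<phi> x - \<psi> x)"
    using \<phi> \<psi> by (intro continuous_intros) (auto simp: creal_def)
  then have "openin K ?V"
    by (rule openin_continuous_map_preimage) simp
  moreover have "?V \<noteq> {}"
  proof
    assume "?V = {}"
    then have "\<forall>x\<in>topspace K. \<phi> x \<le> (\<lambda>x\<in>topspace K. \<psi> x + const_on K c x) x"
      by (fastforce simp: const_on_def)
    then have "\<mu> \<phi> \<le> \<mu> (\<lambda>x\<in>topspace K. \<psi> x + const_on K c x)"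
      using \<mu> \<phi> creal_add_const[OF \<psi>] unfolding O_set_def order_preserving_def by blast
    also have "\<dots> = \<mu> \<psi> + c"
      using \<mu> \<psi> by (simp add: O_set_def weakly_additive_def normed_def)
    finally show False
      using c by simp
  qed
  ultimately show thesis
    using D that unfolding dense_intersects_open by fastforce
qed

lemma O_set_zero:
  assumes "\<mu> \<in> O_set K"
  shows "\<mu> (const_on K 0) = 0"
proof -
  have "(\<lambda>x\<in>topspace K. const_on K 0 x + const_on K 1 x) = const_on K 1"
    by (auto simp: const_on_def)
  moreover have "\<mu> (\<lambda>x\<in>topspace K. const_on K 0 x + const_on K 1 x)
                 = \<mu> (const_on K 0) + 1 * \<mu> (const_on K 1)"
    using assms creal_const unfolding O_set_def weakly_additive_def by blast
  ultimately show ?thesis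
    by simp
qed

text \<open>For each pair \<open>\<phi>, \<psi>\<close> in \<open>\<Phi>\<close> take a point \<open>p\<close> with \<open>\<phi> p - \<psi> p\<close> nearly as large as
  \<open>\<mu> \<phi> - \<mu> \<psi>\<close>, and let the set of index \<open>\<phi>\<close> consist of these points, for all \<open>\<psi>\<close>, with shifts
  \<open>r \<approx> \<mu> \<phi> - \<phi> p\<close>. At \<open>\<phi>\<close> the minimum over its own set is about \<open>\<mu> \<phi>\<close>, which bounds the maximum from
  below; from above, the minimum over the set of any \<open>\<phi>\<close>, evaluated at \<open>\<psi>\<close>, is at most
  \<open>\<psi> p + \<mu> \<phi> - \<phi> p\<close>, hence at most about \<open>\<mu> \<psi>\<close>.\<close>

lemma max_min_approximation:
  assumes \<mu>: "\<mu> \<in> O_set K" and D: "K closure_of D = topspace K"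
    and \<Phi>: "finite \<Phi>" "\<Phi> \<noteq> {}" "\<Phi> \<subseteq> creal K" and \<delta>: "\<delta> > 0"
  obtains L where "L \<in> max_min_index D" "\<And>\<phi>. \<phi> \<in> \<Phi> \<Longrightarrow> \<bar>max_min L \<phi> - \<mu> \<phi>\<bar> \<le> 2 * \<delta>"
proof -
  have "\<exists>p. p \<in> D \<and> \<mu> \<phi> - \<mu> \<psi> - \<delta> < \<phi> p - \<psi> p" if pair: "\<phi> \<in> \<Phi>" "\<psi> \<in> \<Phi>" for \<phi> \<psi>
  proof -
    have "\<phi> \<in> creal K" "\<psi> \<in> creal K" "\<mu> \<phi> - \<mu> \<psi> - \<delta> < \<mu> \<phi> - \<mu> \<psi>"
      using pair \<Phi>(3) \<delta> by auto
    then show ?thesis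
      using O_set_difference_nearly_attained[OF \<mu> _ _ D] by metis
  qed
  then obtain p where p: "\<And>\<phi> \<psi>. \<phi> \<in> \<Phi> \<Longrightarrow> \<psi> \<in> \<Phi> \<Longrightarrow> p \<phi> \<psi> \<in> D \<and> \<mu> \<phi> - \<mu> \<psi> - \<delta> < \<phi> (p \<phi> \<psi>) - \<psi> (p \<phi> \<psi>)"
    by metis
  have "\<exists>r\<in>\<rat>. \<bar>r - t\<bar> < \<delta>" for t :: real
    using Rats_dense_in_real[of "t - \<delta>" "t + \<delta>"] \<delta> by force
  then obtain r where r: "\<And>t. r t \<in> \<rat>" "\<And>t. \<bar>r t - t\<bar> < \<delta>"
    by metis
  define T where "T \<phi> = (\<lambda>\<psi>. (p \<phi> \<psi>, r (\<mu> \<phi> - \<phi> (p \<phi> \<psi>)))) ` \<Phi>" for \<phi>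
  have L: "T ` \<Phi> \<in> max_min_index D"
    using p r(1) \<Phi> by (auto simp: max_min_index_def Fpow_def T_def)
  have fT: "finite (T \<phi>)" "T \<phi> \<noteq> {}" for \<phi>
    using \<Phi> by (auto simp: T_def)
  have "\<bar>max_min (T ` \<Phi>) \<phi> - \<mu> \<phi>\<bar> \<le> 2 * \<delta>" if \<phi>: "\<phi> \<in> \<Phi>" for \<phi>
  proof -
    have "\<mu> \<phi> - \<delta> \<le> (MIN pr\<in>T \<phi>. \<phi> (fst pr) + snd pr)"
    proof (rule Min.boundedI)
      fix y assume "y \<in> (\<lambda>pr. \<phi> (fst pr) + snd pr) ` T \<phi>"
      then obtain \<psi> where "y = \<phi> (p \<phi> \<psi>) + r (\<mu> \<phi> - \<phi> (p \<phi> \<psi>))"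
        by (auto simp: T_def)
      then show "\<mu> \<phi> - \<delta> \<le> y"
        using r(2)[of "\<mu> \<phi> - \<phi> (p \<phi> \<psi>)"] by linarith
    qed (use fT in auto)
    also have "\<dots> \<le> max_min (T ` \<Phi>) \<phi>"
      unfolding max_min_def using \<Phi>(1) \<phi> by (intro Max_ge) auto
    finally have lower: "\<mu> \<phi> - \<delta> \<le> max_min (T ` \<Phi>) \<phi>" .
    have "(MIN pr\<in>T \<xi>. \<phi> (fst pr) + snd pr) \<le> \<mu> \<phi> + 2 * \<delta>" if \<xi>: "\<xi> \<in> \<Phi>" for \<xi>
    proof -
      let ?p = "p \<xi> \<phi>"
      have "(MIN pr\<in>T \<xi>. \<phi> (fst pr) + snd pr) \<le> \<phi> ?p + r (\<mu> \<xi> - \<xi> ?p)"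
        using fT(1) \<phi> by (intro Min_le) (force simp: T_def)+
      then show ?thesis
        using r(2)[of "\<mu> \<xi> - \<xi> ?p"] p[OF \<xi> \<phi>] by linarith
    qed
    then have "max_min (T ` \<Phi>) \<phi> \<le> \<mu> \<phi> + 2 * \<delta>"
      unfolding max_min_def using \<Phi>(1,2) by (intro Max.boundedI) auto
    with lower show ?thesis
      using \<delta> by linarith
  qed
  with L show thesis
    using that by blast
qed

lemma O_space_basic_neighbourhood:
  assumes "openin (O_space K) U" "\<mu> \<in> U"
  obtains \<Phi> \<epsilon> where "finite \<Phi>" "\<Phi> \<subseteq> creal K" "\<epsilon> > 0"
    "\<And>\<nu>. \<nu> \<in> O_set K \<Longrightarrow> (\<And>\<phi>. \<phi> \<in> \<Phi> \<Longrightarrow> \<bar>\<nu> \<phi> - \<mu> \<phi>\<bar> < \<epsilon>) \<Longrightarrow> \<nu> \<in> U"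
proof -
  obtain T where T: "openin (product_topology (\<lambda>_. euclideanreal) (creal K)) T" "U = T \<inter> O_set K"
    using assms(1) by (auto simp: O_space_def pointwise_topology_def openin_subtopology)
  then obtain W where W: "finite {\<phi> \<in> creal K. W \<phi> \<noteq> UNIV}" "\<And>\<phi>. \<phi> \<in> creal K \<Longrightarrow> open (W \<phi>)"
      "\<mu> \<in> PiE (creal K) W" "PiE (creal K) W \<subseteq> T"
    using assms(2) unfolding openin_product_topology_alt by auto
  let ?\<Phi> = "{\<phi> \<in> creal K. W \<phi> \<noteq> UNIV}"
  have "\<exists>e>0. \<forall>y. \<bar>y - \<mu> \<phi>\<bar> < e \<longrightarrow> y \<in> W \<phi>" if "\<phi> \<in> ?\<Phi>" for \<phi>
  proof -
    have "open (W \<phi>)" "\<mu> \<phi> \<in> W \<phi>"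
      using W(2,3) that by auto
    then show ?thesis
      by (simp add: open_dist dist_real_def)
  qed
  then obtain e where e: "\<And>\<phi>. \<phi> \<in> ?\<Phi> \<Longrightarrow> e \<phi> > 0 \<and> (\<forall>y. \<bar>y - \<mu> \<phi>\<bar> < e \<phi> \<longrightarrow> y \<in> W \<phi>)"
    by metis
  define \<epsilon> where "\<epsilon> = Min (insert 1 (e ` ?\<Phi>))"
  have "\<epsilon> > 0"
    unfolding \<epsilon>_def using W(1) e by (subst Min_gr_iff) auto
  have \<epsilon>_le: "\<epsilon> \<le> e \<phi>" if "\<phi> \<in> ?\<Phi>" for \<phi>
    unfolding \<epsilon>_def using W(1) that by (intro Min_le) auto
  show thesis
  proof (rule that[OF W(1) _ \<open>\<epsilon> > 0\<close>])
    fix \<nu> assume \<nu>: "\<nu> \<in> O_set K" and close: "\<And>\<phi>. \<phi> \<in> ?\<Phi> \<Longrightarrow> \<bar>\<nu> \<phi> - \<mu> \<phi>\<bar> < \<epsilon>"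
    have "\<nu> \<phi> \<in> W \<phi>" if "\<phi> \<in> creal K" for \<phi>
    proof (cases "W \<phi> = UNIV")
      case False
      then have "\<phi> \<in> ?\<Phi>" using that by simp
      then show ?thesis
        using e close \<epsilon>_le by (meson less_le_trans)
    qed simp
    moreover have "\<nu> \<in> extensional (creal K)"
      using \<nu> by (simp add: O_set_def)
    ultimately have "\<nu> \<in> PiE (creal K) W"
      by (auto simp: PiE_iff)
    then show "\<nu> \<in> U"
      using W(4) T(2) \<nu> by blast
  qed auto
qed

lemma topspace_O_space: "topspace (O_space K) = O_set K"
  by (auto simp: O_space_def pointwise_topology_def O_set_def PiE_def)

lemma max_min_functionals_dense:
  assumes D: "D \<subseteq> topspace K" "K closure_of D = topspace K"
  shows "O_space K closure_of (max_min_functional K ` max_min_index D) = topspace (O_space K)"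
  unfolding dense_intersects_open
proof (intro allI impI, elim conjE)
  fix U assume U: "openin (O_space K) U" "U \<noteq> {}"
  then obtain \<mu> where "\<mu> \<in> U" by blast
  then have \<mu>: "\<mu> \<in> O_set K"
    using openin_subset[OF U(1)] topspace_O_space by blast
  obtain \<Phi> \<epsilon> where \<Phi>: "finite \<Phi>" "\<Phi> \<subseteq> creal K" "\<epsilon> > 0"
    and nbhd: "\<And>\<nu>. \<nu> \<in> O_set K \<Longrightarrow> (\<And>\<phi>. \<phi> \<in> \<Phi> \<Longrightarrow> \<bar>\<nu> \<phi> - \<mu> \<phi>\<bar> < \<epsilon>) \<Longrightarrow> \<nu> \<in> U"
    using O_space_basic_neighbourhood[OF U(1) \<open>\<mu> \<in> U\<close>] by metis
  \<comment> \<open>The zero function is added so that the normalising term is close to \<open>\<mu> 0 = 0\<close>; both terms then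
    contribute an error of at most \<open>2 * (\<epsilon> / 5)\<close>.\<close>
  obtain L where L: "L \<in> max_min_index D"
    and approx: "\<And>\<phi>. \<phi> \<in> insert (const_on K 0) \<Phi> \<Longrightarrow> \<bar>max_min L \<phi> - \<mu> \<phi>\<bar> \<le> 2 * (\<epsilon> / 5)"
    using max_min_approximation[OF \<mu> D(2), of "insert (const_on K 0) \<Phi>" "\<epsilon> / 5"] \<Phi> creal_const
    by (metis (no_types, lifting) divide_pos_pos finite_insert insert_not_empty insert_subset
        zero_less_numeral)
  have "max_min L (const_on K 0) = max_min L (\<lambda>_. 0) + 0"
    using max_min_indexD(6)[OF L] D(1) by (intro max_min_add_const_cong[OF L]) (auto simp: const_on_def)
  then have zero: "\<bar>max_min L (\<lambda>_. 0)\<bar> \<le> 2 * (\<epsilon> / 5)"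
    using approx[of "const_on K 0"] O_set_zero[OF \<mu>] by simp
  have "max_min_functional K L \<in> U"
  proof (rule nbhd)
    show "max_min_functional K L \<in> O_set K"
      using L D(1) by (rule max_min_functional_in_O_set)
    fix \<phi> assume \<phi>: "\<phi> \<in> \<Phi>"
    then have "max_min_functional K L \<phi> = max_min L \<phi> - max_min L (\<lambda>_. 0)"
      using \<Phi>(2) by (auto simp: max_min_functional_def)
    then show "\<bar>max_min_functional K L \<phi> - \<mu> \<phi>\<bar> < \<epsilon>"
      using approx[OF insertI2[OF \<phi>]] zero \<Phi>(3) by linarith
  qed
  then show "max_min_functional K ` max_min_index D \<inter> U \<noteq> {}"
    using L by blast
qed

lemma card_of_max_min_index_le:
  assumes "infinite D"
  shows "|max_min_index D| \<le>o |D|"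
proof -
  have "|\<rat> :: real set| \<le>o |D|"
  proof -
    obtain f :: "real \<Rightarrow> nat" where "inj_on f \<rat>"
      using countable_rat by (auto simp: countable_def)
    then have "|\<rat> :: real set| \<le>o |UNIV :: nat set|"
      using card_of_ordLeq by blast
    then show ?thesis
      using assms infinite_iff_card_of_nat ordLeq_transitive by blast
  qed
  then have prod: "|D \<times> (\<rat> :: real set)| =o |D|"
    using card_of_Times_infinite[OF assms, of "\<rat> :: real set"] Rats_0 by blast
  then have inf: "infinite (D \<times> (\<rat> :: real set))"
    using assms card_of_ordIso_finite by blast
  then have *: "|Fpow (D \<times> (\<rat> :: real set))| =o |D|"
    using card_of_Fpow_infinite prod ordIso_transitive by blast
  then have "infinite (Fpow (D \<times> (\<rat> :: real set)))"
    using assms card_of_ordIso_finite by blast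
  then have "|Fpow (Fpow (D \<times> (\<rat> :: real set)))| =o |D|"
    using card_of_Fpow_infinite * ordIso_transitive by blast
  moreover have "|max_min_index D| \<le>o |Fpow (Fpow (D \<times> (\<rat> :: real set)))|"
    by (rule card_of_mono1) (auto simp: max_min_index_def)
  ultimately show ?thesis
    using ordLeq_ordIso_trans by blast
qed

section \<open>Functionals depending on finitely many points of the space\<close>

text \<open>The value at \<open>\<phi>\<close> is bounded by the largest \<open>\<bar>\<phi> p\<bar>\<close> over the finitely many nodes, so pointwise
  convergence there is enough; this covers both kinds of nets, monotone ones and those that converge
  uniformly on compact sets.\<close>

lemma max_min_functional_tendsto_zero:
  assumes L: "L \<in> max_min_index D" and dir: "directed I leq" and \<phi>: "\<phi> ` I \<subseteq> creal K"
    and lim: "\<And>p. p \<in> nodes L \<Longrightarrow> ((\<lambda>a. \<phi> a p) \<longlongrightarrow> 0) (tails I leq)"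
  shows "((\<lambda>a. max_min_functional K L (\<phi> a)) \<longlongrightarrow> 0) (tails I leq)"
proof (rule tendstoI)
  fix \<epsilon> :: real assume \<epsilon>: "\<epsilon> > 0"
  have "\<forall>\<^sub>F a in tails I leq. \<forall>p\<in>nodes L. dist (\<phi> a p) 0 < \<epsilon> / 2"
    using max_min_indexD(5)[OF L] tendstoD[OF lim, of _ "\<epsilon> / 2"] \<epsilon>
    by (intro eventually_ball_finite ballI) simp_all
  moreover have "\<forall>\<^sub>F a in tails I leq. a \<in> I"
    using dir unfolding eventually_tails[OF dir] directed_def by blast
  ultimately show "\<forall>\<^sub>F a in tails I leq. dist (max_min_functional K L (\<phi> a)) 0 < \<epsilon>"
  proof eventually_elim
    case (elim a)
    then have "\<bar>max_min_functional K L (\<phi> a)\<bar> \<le> \<epsilon> / 2"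
      using \<phi> by (intro max_min_functional_abs_le[OF L]) (auto simp: less_imp_le)
    then show ?case
      using \<epsilon> by (simp add: dist_real_def)
  qed
qed

text \<open>The max-min expression reads only the values at the nodes, so it also defines a functional on the
  subspace of nodes, which is closed because it is finite.\<close>

lemma max_min_functional_supp:
  assumes K: "Hausdorff_space K" and D: "D \<subseteq> topspace K" and L: "L \<in> max_min_index D"
  shows "supp K (max_min_functional K L) \<subseteq> D"
proof -
  let ?A = "nodes L"
  have A: "?A \<subseteq> D" "finite ?A"
    using max_min_indexD[OF L] by auto
  then have "?A \<subseteq> topspace K"
    using D by blast
  then have top: "topspace (subtopology K ?A) = ?A"
    by auto
  have "L \<in> max_min_index ?A"
    using L by (force simp: max_min_index_def Fpow_def nodes_def)
  then have O: "max_min_functional (subtopology K ?A) L \<in> O_set (subtopology K ?A)"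
    using top by (intro max_min_functional_in_O_set) auto
  have "max_min_functional K L \<phi> = max_min_functional (subtopology K ?A) L (restrict \<phi> ?A)"
    if \<phi>: "\<phi> \<in> creal K" for \<phi>
  proof -
    have "continuous_map (subtopology K ?A) euclideanreal \<phi>"
      using \<phi> by (simp add: creal_def continuous_map_from_subtopology)
    then have "continuous_map (subtopology K ?A) euclideanreal (restrict \<phi> ?A)"
      by (rule continuous_map_eq) auto
    then have "restrict \<phi> ?A \<in> creal (subtopology K ?A)"
      unfolding creal_def top by simp
    moreover have "max_min L \<phi> = max_min L (restrict \<phi> ?A)"
      using max_min_add_const_cong[OF L, of \<phi> "restrict \<phi> ?A" 0] by simp
    ultimately show ?thesis
      using \<phi> by (simp add: max_min_functional_def)
  qed
  with O have "supported_on K ?A (max_min_functional K L)"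
    unfolding supported_on_def by blast
  moreover have "closedin K ?A"
    using A(2) \<open>?A \<subseteq> topspace K\<close> K by (simp add: closedin_Hausdorff_finite)
  ultimately show ?thesis
    using A(1) unfolding supp_def by blast
qed

lemma
  assumes L: "L \<in> max_min_index (beta_emb X ` topspace X)"
  shows max_min_functional_in_O_tau_set: "max_min_functional (Stone_Cech X) L \<in> O_tau_set X"
    and max_min_functional_in_O_R_set: "max_min_functional (Stone_Cech X) L \<in> O_R_set X"
    and max_min_functional_in_O_beta_set: "max_min_functional (Stone_Cech X) L \<in> O_beta_set X"
proof -
  let ?\<nu> = "max_min_functional (Stone_Cech X) L"
  have O: "?\<nu> \<in> O_set (Stone_Cech X)"
    using L beta_emb_in_Stone_Cech by (rule max_min_functional_in_O_set)
  have node: "\<exists>x\<in>topspace X. p = beta_emb X x" if "p \<in> nodes L" for p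
    using max_min_indexD(6)[OF L] that by blast
  have "tau_smooth X ?\<nu>"
    unfolding tau_smooth_def
  proof (intro allI impI, elim conjE)
    fix I :: "('a beta \<Rightarrow> real) set set" and le \<phi>
    assume "directed I le" "\<phi> ` I \<subseteq> creal (Stone_Cech X)" and dec: "decreasing_to_zero X I le \<phi>"
    then show "((\<lambda>a. ?\<nu> (\<phi> a)) \<longlongrightarrow> 0) (tails I le)"
      using node dec unfolding decreasing_to_zero_def
      by (intro max_min_functional_tendsto_zero[OF L]) blast+
  qed
  with O show "?\<nu> \<in> O_tau_set X"
    by (simp add: O_tau_set_def)
  have "Radon X ?\<nu>"
    unfolding Radon_def
  proof (intro allI impI, elim conjE)
    fix I :: "('a beta \<Rightarrow> real) set set" and le \<phi>
    assume I: "directed I le" "\<phi> ` I \<subseteq> creal (Stone_Cech X)" and zero: "zero_on_compacts X I le \<phi>"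
    show "((\<lambda>a. ?\<nu> (\<phi> a)) \<longlongrightarrow> 0) (tails I le)"
    proof (rule max_min_functional_tendsto_zero[OF L I])
      fix p assume "p \<in> nodes L"
      then obtain x where x: "x \<in> topspace X" "p = beta_emb X x"
        using node by blast
      then have "uniform_limit (beta_emb X ` {x}) \<phi> (\<lambda>_. 0) (tails I le)"
        using zero unfolding zero_on_compacts_def by (metis compactin_sing)
      then show "((\<lambda>a. \<phi> a p) \<longlongrightarrow> 0) (tails I le)"
        using x by (auto dest: tendsto_uniform_limitI)
    qed
  qed
  with O show "?\<nu> \<in> O_R_set X"
    by (simp add: O_R_set_def)
  show "?\<nu> \<in> O_beta_set X"
    using O max_min_functional_supp[OF Hausdorff_space_Stone_Cech beta_emb_in_Stone_Cech L]
    by (simp add: O_beta_set_def)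
qed

section \<open>Weak densities of the spaces of functionals\<close>

lemma dense_infinite:
  assumes "Hausdorff_space K" "D \<subseteq> topspace K" "K closure_of D = topspace K" "infinite (topspace K)"
  shows "infinite D"
proof
  assume "finite D"
  then have "closedin K D"
    using assms by (simp add: closedin_Hausdorff_finite)
  then show False
    using assms \<open>finite D\<close> by (simp add: closure_of_closedin)
qed

text \<open>The dense set that bounds the weak density uses nodes in a small dense subset of \<open>\<beta>X\<close>, which may
  lie outside \<open>X\<close> and give functionals outside \<open>M\<close>; the density of \<open>M\<close> comes from nodes in \<open>X\<close>.\<close>

lemma weak_density_pointwise_le:
  assumes X: "Tychonoff_space X" "infinite (topspace X)"
    and M: "M \<subseteq> O_set (Stone_Cech X)"
      "max_min_functional (Stone_Cech X) ` max_min_index (beta_emb X ` topspace X) \<subseteq> M"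
  shows "weak_density (pointwise_topology (Stone_Cech X) M) \<le>o weak_density X"
proof -
  let ?K = "Stone_Cech X"
  have emb: "continuous_map X ?K (beta_emb X)" "inj_on (beta_emb X) (topspace X)"
    using embedding_map_beta_emb[OF X(1)] homeomorphic_imp_continuous_map
      homeomorphic_imp_injective_map continuous_map_in_subtopology
    unfolding embedding_map_def by blast+
  obtain \<S> where S: "centered_pi_cover X \<S>" "weak_density X = |\<S>|"
    by (metis weak_density_attained)
  obtain D where D: "D \<subseteq> topspace ?K" "?K closure_of D = topspace ?K" "|D| \<le>o |\<S>|"
    using centered_pi_cover_dense_set[OF S(1) compact_space_Stone_Cech Hausdorff_space_Stone_Cech
        emb(1) Stone_Cech_dense] by blast
  have "infinite (topspace ?K)"
    using X(2) emb(2) beta_emb_in_Stone_Cech finite_imageD finite_subset by metis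
  then have inf: "infinite D"
    using dense_infinite[OF Hausdorff_space_Stone_Cech D(1,2)] by blast
  let ?E = "max_min_functional ?K ` max_min_index D"
  have "?E \<subseteq> O_set ?K"
    using D(1) max_min_functional_in_O_set by blast
  have "topspace (O_space ?K) \<subseteq> O_space ?K closure_of M"
    using closure_of_mono[OF M(2)]
      max_min_functionals_dense[OF beta_emb_in_Stone_Cech Stone_Cech_dense] by metis
  then have dense: "O_space ?K closure_of M = topspace (O_space ?K)"
    by (simp add: closure_of_subset_topspace subset_antisym)
  have "pointwise_topology ?K M = subtopology (O_space ?K) M"
    using M(1) by (simp add: pointwise_topology_def O_space_def subtopology_subtopology inf.absorb2)
  then have "weak_density (pointwise_topology ?K M) \<le>o |?E|"
    using weak_density_dense_subspace_le[OF max_min_functionals_dense[OF D(1,2)] dense] by simp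
  also have "|?E| \<le>o |max_min_index D|"
    by (rule card_of_image)
  also have "|max_min_index D| \<le>o |D|"
    using inf by (rule card_of_max_min_index_le)
  also have "|D| \<le>o weak_density X"
    using D(3) S(2) by simp
  finally show ?thesis .
qed

theorem corollary4:
  fixes X :: "'a topology"
  assumes "Tychonoff_space X" and "infinite (topspace X)"
  shows "weak_density (O_space (Stone_Cech X)) \<le>o weak_density X \<and>
         weak_density (O_tau X) \<le>o weak_density X \<and>
         weak_density (O_R X) \<le>o weak_density X \<and>
         weak_density (O_beta X) \<le>o weak_density X"
  unfolding O_space_def O_tau_def O_R_def O_beta_def
proof (intro conjI)
  let ?K = "Stone_Cech X" and ?I = "max_min_index (beta_emb X ` topspace X)"
  have "max_min_functional ?K ` ?I \<subseteq> O_set ?K"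
    using max_min_functional_in_O_set[OF _ beta_emb_in_Stone_Cech] by blast
  then show "weak_density (pointwise_topology ?K (O_set ?K)) \<le>o weak_density X"
    using weak_density_pointwise_le[OF assms subset_refl] by blast
  have "O_tau_set X \<subseteq> O_set ?K" "max_min_functional ?K ` ?I \<subseteq> O_tau_set X"
    using max_min_functional_in_O_tau_set by (auto simp only: O_tau_set_def)
  then show "weak_density (pointwise_topology ?K (O_tau_set X)) \<le>o weak_density X"
    by (rule weak_density_pointwise_le[OF assms])
  have "O_R_set X \<subseteq> O_set ?K" "max_min_functional ?K ` ?I \<subseteq> O_R_set X"
    using max_min_functional_in_O_R_set by (auto simp only: O_R_set_def)
  then show "weak_density (pointwise_topology ?K (O_R_set X)) \<le>o weak_density X"
    by (rule weak_density_pointwise_le[OF assms])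
  have "O_beta_set X \<subseteq> O_set ?K" "max_min_functional ?K ` ?I \<subseteq> O_beta_set X"
    using max_min_functional_in_O_beta_set by (auto simp only: O_beta_set_def)
  then show "weak_density (pointwise_topology ?K (O_beta_set X)) \<le>o weak_density X"
    by (rule weak_density_pointwise_le[OF assms])
qed

end
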